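(* Suppose $\alpha\in(1,2)$ and $\beta\in[0,\alpha-1)\cup(\alpha,\infty)$. Then the inequality $|E_{\alpha,\beta}(z)|\ge E_{\alpha,\beta}(\Re z)$ does not hold globally, i.e. there exists $z\in\mathbb{C}$ with $|E_{\alpha,\beta}(z)|<E_{\alpha,\beta}(\Re z)$.
   Context: For $\alpha>0$ and $\beta\in\mathbb{R}$, the two-parameter Mittag-Leffler function is the entire function $E_{\alpha,\beta}(z)=\sum_{k=0}^{\infty}\frac{z^k}{\Gamma(\alpha k+\beta)}$, $z\in\mathbb{C}$, with the convention $1/\Gamma(s)=0$ at the poles $s=0,-1,-2,\dots$ of $\Gamma$. $\Re z$ denotes the real part of $z$; $E_{\alpha,\beta}$ is real-valued on $\mathbb{R}$. *)

theory Defs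
  imports "HOL-Analysis.Analysis"
begin

(* rGamma is the entire reciprocal Gamma function, equal to 0 at 0, -1, -2, ... *)
definition Mittag_Leffler :: "real \<Rightarrow> real \<Rightarrow> complex \<Rightarrow> complex" where
  "Mittag_Leffler \<alpha> \<beta> z = (\<Sum>k. z ^ k * rGamma (complex_of_real (\<alpha> * real k + \<beta>)))"

end

theory Submission
  imports Defs "HOL-Complex_Analysis.Complex_Analysis" "HOL-Real_Asymp.Real_Asymp"
begin

text \<open>
  Write \<open>\<gamma> = \<beta> - \<alpha>\<close>. Since \<open>z E\<^bsub>\<alpha>,\<beta>\<^esub>(z) = E\<^bsub>\<alpha>,\<gamma>\<^esub>(z) - 1/\<Gamma>(\<gamma>)\<close>, the decay
  \<open>E\<^bsub>\<alpha>,\<gamma>\<^esub>(z) = O(|z|\<^sup>-\<^sup>1\<^sup>/\<^sup>2)\<close> in a sector around the negative axis gives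
  \<open>E\<^bsub>\<alpha>,\<beta>\<^esub>(z) \<sim> -1/(\<Gamma>(\<gamma>) z)\<close> there, and the hypotheses on \<open>\<beta>\<close> ensure
  \<open>\<Gamma>(\<gamma>) > 0\<close>. For \<open>z = -R e\<^sup>i\<^sup>\<theta>\<close> with \<open>R\<close> large, \<open>|E(z)|\<close> is about \<open>1/(\<Gamma>(\<gamma>) R)\<close>, whereas
  \<open>E(Re z)\<close> is about \<open>1/(\<Gamma>(\<gamma>) R cos \<theta>)\<close>, which is larger.

  The decay comes from a Mellin--Barnes argument: with \<open>z = -e\<^sup>L\<close>, the partial sums of the
  series are contour integrals of \<open>\<pi> e\<^sup>s\<^sup>L / (\<Gamma>(\<alpha> s + \<gamma>) sin (\<pi> s))\<close> over rectangles between the lines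
  \<open>Re s = -1/2\<close> and \<open>Re s = n - 1/2\<close>, and \<open>1/\<Gamma>\<close> grows on vertical lines only like \<open>e\<close> to the power
  \<open>(\<pi>/2 + \<epsilon>) |Im|\<close>.
\<close>

section \<open>Growth of \<open>1/Gamma\<close> on vertical lines and strips\<close>

text \<open>The reflection formula at \<open>\<i> * y\<close> evaluates the product of the values at
  \<open>1 + \<i> * y\<close> and its conjugate, so the squared modulus equals
  \<open>sinh (pi * y) / (pi * y)\<close>; then \<open>sinh t \<le> t * exp t\<close> for
  \<open>t \<ge> 0\<close>.\<close>

lemma norm_rGamma_Complex_1_le:
  fixes y :: real
  shows "norm (rGamma (Complex 1 y)) \<le> exp (pi * \<bar>y\<bar> / 2)"
proof (cases "y = 0")
  case True
  then show ?thesis by (simp add: Complex_eq)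
next
  case False
  have "rGamma (Complex 1 y) * rGamma (Complex 1 (-y)) * (\<i> * y)
      = (\<i> * y * rGamma (\<i> * y + 1)) * rGamma (1 - \<i> * y)"
    by (simp add: Complex_eq mult_ac add.commute)
  also have "\<dots> = sin (of_real pi * (\<i> * y)) / of_real pi"
    unfolding rGamma_plus1 by (rule rGamma_reflection_complex)
  finally have arg: "rGamma (Complex 1 y) * rGamma (Complex 1 (-y)) * (\<i> * y)
      = sin (of_real pi * (\<i> * y)) / of_real pi" .
  have cn: "rGamma (Complex 1 (-y)) = cnj (rGamma (Complex 1 y))"
    by (simp add: cnj_rGamma complex_cnj)
  have sh: "sin (of_real pi * (\<i> * y)) = \<i> * of_real (sinh (pi * y))"
    using sin_i_times[of "of_real (pi * y)"]
    by (simp add: sinh_field_def exp_minus algebra_simps of_real_inverse exp_of_real flip: exp_of_real)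
  have "norm (rGamma (Complex 1 y)) ^ 2 * \<bar>y\<bar> = \<bar>sinh (pi * y)\<bar> / pi"
    using arg_cong[OF arg, of norm] unfolding cn sh
    by (simp add: norm_mult norm_divide power2_eq_square)
  also have "\<bar>sinh (pi * y)\<bar> = sinh (pi * \<bar>y\<bar>)"
    by (cases "y \<ge> 0") (auto simp: abs_if mult_less_0_iff)
  also have "sinh (pi * \<bar>y\<bar>) \<le> pi * \<bar>y\<bar> * exp (pi * \<bar>y\<bar>)"
  proof -
    define t where "t = pi * \<bar>y\<bar>"
    \<comment> \<open>\<open>2 * sinh t = exp t * (1 - exp (- 2 * t))\<close>, and the bracket is at
      most \<open>2 * t\<close>.\<close>
    have "1 - 2 * t \<le> exp (- (2 * t))" using exp_ge_add_one_self[of "- (2 * t)"] by simp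
    then have "exp t * (1 - exp (- (2 * t))) \<le> exp t * (2 * t)"
      by (intro mult_left_mono) auto
    then show ?thesis
      unfolding t_def[symmetric] sinh_field_def
      by (simp add: algebra_simps flip: exp_add)
  qed
  finally have "norm (rGamma (Complex 1 y)) ^ 2 * \<bar>y\<bar> \<le> exp (pi * \<bar>y\<bar>) * \<bar>y\<bar>"
    by (simp add: field_simps)
  then have "norm (rGamma (Complex 1 y)) ^ 2 \<le> exp (pi * \<bar>y\<bar> / 2) ^ 2"
    using False by (simp add: exp_double[symmetric])
  then show ?thesis by (rule power2_le_imp_le) simp
qed

text \<open>
  The product for \<open>1/\<Gamma>\<close> is compared factor by factor with that at \<open>1 + i y\<close>, where the
  reflection formula gives the exact modulus.
\<close>
lemma norm_rGamma_le:
  fixes z :: complex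
  assumes "Re z \<ge> 1"
  shows "norm (rGamma z) \<le> rGamma (Re z) * exp (pi * \<bar>Im z\<bar> / 2)"
proof -
  define a y where "a = Re z" and "y = Im z"
  have z: "z = Complex a y" by (simp add: a_def y_def)
  have a: "a \<ge> 1" using assms by (simp add: a_def)
  have poch: "norm (pochhammer z m) * pochhammer 1 m \<le> norm (pochhammer (Complex 1 y) m) * pochhammer a m" for m
  proof -
    have "norm (z + of_nat k) * (1 + real k) \<le> norm (Complex 1 y + of_nat k) * (a + real k)" for k
    proof (rule power2_le_imp_le)
      \<comment> \<open>After squaring, both sides share the term
        \<open>(a + k)^2 * (1 + k)^2\<close>; what is left is this comparison, where
        \<open>a \<ge> 1\<close> enters.\<close>
      have "y\<^sup>2 * (1 + real k)\<^sup>2 \<le> y\<^sup>2 * (a + real k)\<^sup>2"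
        using a by (intro mult_left_mono power_mono) auto
      then show "(norm (z + of_nat k) * (1 + real k))\<^sup>2 \<le> (norm (Complex 1 y + of_nat k) * (a + real k))\<^sup>2"
        unfolding power_mult_distrib cmod_power2 by (simp add: z) argo
    qed (use a in auto)
    then have "(\<Prod>k = 0..<m. norm (z + of_nat k) * (1 + real k))
        \<le> (\<Prod>k = 0..<m. norm (Complex 1 y + of_nat k) * (a + real k))"
      by (intro prod_mono) auto
    then show ?thesis
      by (simp add: pochhammer_prod prod.distrib prod_norm)
  qed
  \<comment> \<open>The modulus of the normalising factor \<open>fact m * exp (z * ln m)\<close>
    depends only on \<open>Re z\<close>, so the two sides carry the same total normalisation and the
    Pochhammer bound transfers.\<close>
  have "norm (rGamma_series z m) * rGamma_series 1 m
      \<le> norm (rGamma_series (Complex 1 y) m) * rGamma_series a m" for m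
    using divide_right_mono[OF poch[of "m + 1"], of "(fact m * exp (a * ln (real m))) * (fact m * exp (ln (real m)))"]
    by (simp add: rGamma_series_def norm_divide norm_mult z mult_ac del: pochhammer_Suc)
  moreover have "(\<lambda>m. norm (rGamma_series z m) * rGamma_series 1 m) \<longlonglongrightarrow> norm (rGamma z) * rGamma 1"
    by (intro tendsto_intros)
  moreover have "(\<lambda>m. norm (rGamma_series (Complex 1 y) m) * rGamma_series a m)
      \<longlonglongrightarrow> norm (rGamma (Complex 1 y)) * rGamma a"
    by (intro tendsto_intros)
  ultimately have "norm (rGamma z) * rGamma 1 \<le> norm (rGamma (Complex 1 y)) * rGamma a"
    by (intro LIMSEQ_le) auto
  also have "\<dots> \<le> exp (pi * \<bar>y\<bar> / 2) * rGamma a"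
  proof (rule mult_right_mono[OF norm_rGamma_Complex_1_le])
    show "rGamma a \<ge> 0" using a by (simp add: rGamma_inverse_Gamma Gamma_real_nonneg)
  qed
  finally show ?thesis by (simp add: a_def y_def mult.commute)
qed

text \<open>The recurrence \<open>1/Gamma(z) = z/Gamma(z + 1)\<close> pushes the strip to the right,
  by induction, until \<open>Re z \<ge> 1\<close>. Each step costs a factor \<open>norm z\<close>,
  which half of the current \<open>\<epsilon>\<close> absorbs; hence \<open>\<epsilon>\<close> is
  generalised in the induction.\<close>

lemma rGamma_strip_bound:
  fixes a b \<epsilon> :: real
  assumes "\<epsilon> > 0"
  shows "\<exists>C\<ge>0. \<forall>z :: complex. a \<le> Re z \<and> Re z \<le> b \<longrightarrow> norm (rGamma z) \<le> C * exp ((pi / 2 + \<epsilon>) * \<bar>Im z\<bar>)"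
proof -
  obtain m :: nat where "real m \<ge> 1 - a" by (meson real_arch_simple)
  then have "a \<ge> 1 - real m" by linarith
  with assms show ?thesis
  proof (induction m arbitrary: a b \<epsilon>)
    case (0 a b \<epsilon>)
    have "bounded (rGamma ` {a..b})"
      by (intro compact_imp_bounded compact_continuous_image continuous_intros) auto
    then obtain C where C: "\<bar>rGamma x\<bar> \<le> C" if "x \<in> {a..b}" for x
      unfolding bounded_iff by force
    \<comment> \<open>For \<open>b < a\<close> the interval is empty and \<open>C\<close> may be
      negative; \<open>max C 0\<close> covers that case.\<close>
    show ?case
    proof (intro exI[of _ "max C 0"] conjI allI impI)
      fix z :: complex assume z: "a \<le> Re z \<and> Re z \<le> b"
      have "norm (rGamma z) \<le> rGamma (Re z) * exp (pi * \<bar>Im z\<bar> / 2)"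
        using z 0 by (intro norm_rGamma_le) auto
      also have "\<dots> \<le> max C 0 * exp ((pi / 2 + \<epsilon>) * \<bar>Im z\<bar>)"
      proof (intro mult_mono)
        have "\<epsilon> * \<bar>Im z\<bar> \<ge> 0" using 0 by simp
        then have "pi * \<bar>Im z\<bar> / 2 \<le> (pi / 2 + \<epsilon>) * \<bar>Im z\<bar>" by (simp add: distrib_right)
        then show "exp (pi * \<bar>Im z\<bar> / 2) \<le> exp ((pi / 2 + \<epsilon>) * \<bar>Im z\<bar>)" by (simp only: exp_le_cancel_iff)
      qed (use C[of "Re z"] z in auto)
      finally show "norm (rGamma z) \<le> max C 0 * exp ((pi / 2 + \<epsilon>) * \<bar>Im z\<bar>)" .
    qed auto
  next
    case (Suc m a b \<epsilon>)
    from Suc.prems have "\<epsilon> / 2 > 0" "a + 1 \<ge> 1 - real m" by simp_all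
    from Suc.IH[OF this, of "b + 1"] obtain C where C: "C \<ge> 0"
        "\<And>z :: complex. a + 1 \<le> Re z \<Longrightarrow> Re z \<le> b + 1 \<Longrightarrow>
          norm (rGamma z) \<le> C * exp ((pi / 2 + \<epsilon> / 2) * \<bar>Im z\<bar>)"
      by metis
    \<comment> \<open>\<open>K\<close> bounds \<open>norm z\<close> relative to
      \<open>exp (\<epsilon> / 2 * \<bar>Im z\<bar>)\<close>: the real part contributes at most
      \<open>\<bar>a\<bar> + \<bar>b\<bar>\<close>, and \<open>t \<le> exp t\<close> at
      \<open>t = \<epsilon> / 2 * \<bar>Im z\<bar>\<close> gives the
      \<open>2 / \<epsilon>\<close>.\<close>
    define K where "K = \<bar>a\<bar> + \<bar>b\<bar> + 2 / \<epsilon>"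
    have K: "K \<ge> 0" using Suc.prems by (auto simp: K_def)
    show ?case
    proof (intro exI[of _ "K * C"] conjI allI impI)
      show "0 \<le> K * C" using K C by simp
      fix z :: complex assume z: "a \<le> Re z \<and> Re z \<le> b"
      have "norm z \<le> \<bar>Re z\<bar> + \<bar>Im z\<bar>" by (rule cmod_le)
      also have "\<dots> \<le> (\<bar>a\<bar> + \<bar>b\<bar>) * 1 + 2 / \<epsilon> * (\<epsilon> / 2 * \<bar>Im z\<bar>)" using z Suc.prems by auto
      also have "\<dots> \<le> (\<bar>a\<bar> + \<bar>b\<bar>) * exp (\<epsilon> / 2 * \<bar>Im z\<bar>) + 2 / \<epsilon> * exp (\<epsilon> / 2 * \<bar>Im z\<bar>)"
      proof (intro add_mono mult_left_mono)
        show "\<epsilon> / 2 * \<bar>Im z\<bar> \<le> exp (\<epsilon> / 2 * \<bar>Im z\<bar>)"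
          using exp_ge_add_one_self[of "\<epsilon> / 2 * \<bar>Im z\<bar>"] by linarith
      qed (use Suc.prems in auto)
      finally have nz: "norm z \<le> K * exp (\<epsilon> / 2 * \<bar>Im z\<bar>)" by (simp add: K_def algebra_simps)
      have "norm (rGamma z) = norm z * norm (rGamma (z + 1))"
        by (metis norm_mult rGamma_plus1)
      also have "\<dots> \<le> (K * exp (\<epsilon> / 2 * \<bar>Im z\<bar>)) * (C * exp ((pi / 2 + \<epsilon> / 2) * \<bar>Im z\<bar>))"
        using C(2)[of "z + 1"] z K by (intro mult_mono nz) auto
      also have "\<dots> = K * C * exp ((pi / 2 + \<epsilon>) * \<bar>Im z\<bar>)"
      proof -
        have "exp (\<epsilon> / 2 * \<bar>Im z\<bar>) * exp ((pi / 2 + \<epsilon> / 2) * \<bar>Im z\<bar>) = exp ((pi / 2 + \<epsilon>) * \<bar>Im z\<bar>)"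
          unfolding exp_add[symmetric] distrib_right[symmetric] by simp
        then show ?thesis by (metis mult.assoc mult.left_commute)
      qed
      finally show "norm (rGamma z) \<le> K * C * exp ((pi / 2 + \<epsilon>) * \<bar>Im z\<bar>)" .
    qed
  qed
qed

section \<open>Super-exponential decay of \<open>1/Gamma\<close> along the positive axis\<close>

text \<open>With \<open>m + 1\<close> the integer part of \<open>x\<close>, monotonicity gives
  \<open>Gamma x \<ge> fact m\<close>, so the quotient is dominated by a multiple of the term
  \<open>K ^ m / fact m\<close> of a convergent exponential series.\<close>

lemma exp_mult_rGamma_tendsto_0:
  fixes c :: real
  shows "((\<lambda>x. exp (c * x) * rGamma x) \<longlongrightarrow> 0) at_top"
proof (rule tendsto_sandwich[of "\<lambda>_. 0"])
  define K where "K = exp \<bar>c\<bar>"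
  define F where "F = (\<lambda>m. K ^ m / fact m)"
  show "\<forall>\<^sub>F x in at_top. 0 \<le> exp (c * x) * rGamma x"
    using eventually_ge_at_top[of 1]
    by eventually_elim (simp add: rGamma_inverse_Gamma Gamma_real_nonneg)
  \<comment> \<open>Taking \<open>x \<ge> 2\<close> forces \<open>m \<ge> 1\<close>, so
    \<open>Gamma\<close> is increasing on \<open>[m + 1, x]\<close>. The factor \<open>K ^ 2\<close>
    pays for \<open>x < m + 2\<close>.\<close>
  show "\<forall>\<^sub>F x in at_top. exp (c * x) * rGamma x \<le> K ^ 2 * F (nat \<lfloor>x\<rfloor> - 1)"
    using eventually_ge_at_top[of 2]
  proof eventually_elim
    case (elim x)
    define m where "m = nat \<lfloor>x\<rfloor> - 1"
    have m: "real m + 1 \<le> x" "x < real m + 2" "m \<ge> 1"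
      using elim unfolding m_def by linarith+
    have "c * x \<le> \<bar>c\<bar> * (real m + 2)"
      using m by (intro mult_mono) auto
    then have "exp (c * x) \<le> exp (\<bar>c\<bar> * real (m + 2))" by (simp add: add.commute)
    also have "\<dots> = K ^ (m + 2)" unfolding K_def by (subst mult.commute) (rule exp_of_nat_mult)
    finally have "exp (c * x) \<le> K ^ 2 * K ^ m" by (simp add: power2_eq_square mult.assoc)
    moreover have "fact m \<le> Gamma x"
    proof (cases "x = real m + 1")
      case True
      then show ?thesis using Gamma_fact[of m, where ?'a = real] by (simp add: add.commute)
    next
      case False
      then have "Gamma (1 + real m) < Gamma x"
        using m by (intro Gamma_real_strict_mono) auto
      then show ?thesis using Gamma_fact[of m, where ?'a = real] by simp
    qed
    then have "rGamma x \<le> inverse (fact m)"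
      unfolding rGamma_inverse_Gamma by (intro le_imp_inverse_le) auto
    ultimately have "exp (c * x) * rGamma x \<le> (K ^ 2 * K ^ m) * inverse (fact m)"
      using m elim by (intro mult_mono) (auto simp: K_def rGamma_inverse_Gamma Gamma_real_nonneg)
    then show ?case by (simp add: F_def m_def field_simps)
  qed
  have "F \<longlonglongrightarrow> 0"
    using summable_LIMSEQ_zero[OF summable_exp[of K]] by (simp add: F_def field_simps)
  moreover have "filterlim (\<lambda>x::real. nat \<lfloor>x\<rfloor> - 1) at_top at_top"
  proof (rule filterlim_at_top[THEN iffD2], rule allI)
    fix Z :: nat
    show "\<forall>\<^sub>F x::real in at_top. Z \<le> nat \<lfloor>x\<rfloor> - 1"
      using eventually_ge_at_top[of "real Z + 1"] by eventually_elim linarith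
  qed
  ultimately have "((\<lambda>x::real. F (nat \<lfloor>x\<rfloor> - 1)) \<longlongrightarrow> 0) at_top"
    by (rule filterlim_compose)
  then show "((\<lambda>x::real. K ^ 2 * F (nat \<lfloor>x\<rfloor> - 1)) \<longlongrightarrow> 0) at_top"
    by (rule tendsto_mult_right_zero)
qed auto

section \<open>Estimates for the sides of the rectangle\<close>

lemma exp_abs_integral:
  fixes \<eta> T :: real
  assumes "\<eta> > 0" "T \<ge> 0"
  shows "\<exists>I \<le> 2 / \<eta>. ((\<lambda>y. exp (- \<eta> * \<bar>y\<bar>)) has_integral I) {-T..T}"
proof -
  have "((\<lambda>y. exp (\<eta> * y)) has_integral (exp (\<eta> * 0) / \<eta> - exp (\<eta> * (-T)) / \<eta>)) {-T..0}"
    using assms by (intro fundamental_theorem_of_calculus)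
      (auto intro!: derivative_eq_intros simp flip: has_real_derivative_iff_has_vector_derivative)
  then have 1: "((\<lambda>y. exp (- \<eta> * \<bar>y\<bar>)) has_integral (1 - exp (- \<eta> * T)) / \<eta>) {-T..0}"
    by (subst has_integral_cong[of _ _ "\<lambda>y. exp (\<eta> * y)"]) (auto simp: diff_divide_distrib)
  have "((\<lambda>y. exp (- \<eta> * y)) has_integral (- exp (- \<eta> * T) / \<eta> - (- exp (- \<eta> * 0) / \<eta>))) {0..T}"
    using assms by (intro fundamental_theorem_of_calculus)
      (auto intro!: derivative_eq_intros simp flip: has_real_derivative_iff_has_vector_derivative)
  then have 2: "((\<lambda>y. exp (- \<eta> * \<bar>y\<bar>)) has_integral (1 - exp (- \<eta> * T)) / \<eta>) {0..T}"
    by (subst has_integral_cong[of _ _ "\<lambda>y. exp (- \<eta> * y)"]) (auto simp: diff_divide_distrib)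
  have "((\<lambda>y. exp (- \<eta> * \<bar>y\<bar>)) has_integral (1 - exp (- \<eta> * T)) / \<eta> + (1 - exp (- \<eta> * T)) / \<eta>) {-T..T}"
    using assms by (intro has_integral_combine[OF _ _ 1 2]) auto
  moreover have "(1 - exp (- \<eta> * T)) / \<eta> + (1 - exp (- \<eta> * T)) / \<eta> \<le> 2 / \<eta>"
    using assms by (simp add: field_simps)
  ultimately show ?thesis by blast
qed

text \<open>Exponential decay in both directions is integrable over the whole line, so the bound is
  free of \<open>T\<close> and survives when the height of the rectangle tends to infinity.\<close>

lemma contour_integral_vertical_bound:
  fixes f :: "complex \<Rightarrow> complex"
  assumes "\<eta> > 0" "T > 0" "M \<ge> 0"
    and cont: "continuous_on (closed_segment (Complex c (-T)) (Complex c T)) f"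
    and bd: "\<And>y. norm (f (Complex c y)) \<le> M * exp (- \<eta> * \<bar>y\<bar>)"
  shows "norm (contour_integral (linepath (Complex c (-T)) (Complex c T)) f) \<le> 2 * M / \<eta>"
proof -
  define J where "J = contour_integral (linepath (Complex c (-T)) (Complex c T)) f"
  have "(f has_contour_integral J) (linepath (Complex c (-T)) (Complex c T))"
    unfolding J_def by (intro has_contour_integral_integral contour_integrable_continuous_linepath cont)
  then have J: "((\<lambda>y. f (Complex c y)) has_integral (- \<i> * J)) {-T..T}"
    using assms(2) by (subst (asm) has_contour_integral_linepath_same_Re_iff) auto
  obtain I where I: "I \<le> 2 / \<eta>" "((\<lambda>y. exp (- \<eta> * \<bar>y\<bar>)) has_integral I) {-T..T}"
    using exp_abs_integral[of \<eta> T] assms by auto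
  have MI: "((\<lambda>y. M * exp (- \<eta> * \<bar>y\<bar>)) has_integral (M * I)) {-T..T}"
    using has_integral_mult_right[OF I(2)] .
  have "norm (integral {-T..T} (\<lambda>y. f (Complex c y))) \<le> integral {-T..T} (\<lambda>y. M * exp (- \<eta> * \<bar>y\<bar>))"
    using J MI by (intro integral_norm_bound_integral bd) (auto simp: integrable_on_def)
  also have "\<dots> = M * I" using MI by (rule integral_unique)
  also have "\<dots> \<le> M * (2 / \<eta>)" using I assms by (intro mult_left_mono) auto
  finally show ?thesis unfolding integral_unique[OF J] by (simp add: norm_mult J_def mult.commute)
qed

text \<open>Meant for horizontal sides, where the real part is arbitrary: once
  \<open>\<bar>Im z\<bar> \<ge> 1\<close>, the cosine term in the formula for the squared modulus is
  at most half of \<open>exp (2 * \<bar>Im z\<bar>)\<close>.\<close>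

lemma norm_sin_ge:
  fixes z :: complex
  assumes "\<bar>Im z\<bar> \<ge> 1"
  shows "norm (sin z) \<ge> exp \<bar>Im z\<bar> / 4"
proof (rule power2_le_imp_le)
  have "exp (2::real) \<ge> 4"
    using exp_ge_add_one_self[of 1] power_mono[of 2 "exp 1 :: real" 2] exp_double[of "1::real"] by simp
  moreover have "exp (2::real) \<le> exp (2 * \<bar>Im z\<bar>)" using assms by simp
  ultimately have "exp (2 * \<bar>Im z\<bar>) \<ge> 4" by linarith
  moreover have "exp (2 * Im z) + inverse (exp (2 * Im z)) \<ge> exp (2 * \<bar>Im z\<bar>)"
    by (cases "Im z \<ge> 0") (auto simp: exp_minus)
  moreover have "cos (2 * Re z) \<le> 1" by simp
  ultimately have "exp (2 * \<bar>Im z\<bar>) / 16 \<le> (exp (2 * Im z) + inverse (exp (2 * Im z)) - 2 * cos (2 * Re z)) / 4"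
    by argo
  then show "(exp \<bar>Im z\<bar> / 4)\<^sup>2 \<le> (norm (sin z))\<^sup>2"
    unfolding norm_sin_squared by (simp add: power_divide exp_double)
qed simp

text \<open>Meant for vertical sides through half-odd multiples of \<open>pi\<close>: there the
  cosine term only helps, so the bound holds down to the real axis.\<close>

lemma norm_sin_half_odd_ge:
  fixes z :: complex
  assumes "cos (2 * Re z) = -1"
  shows "norm (sin z) \<ge> exp \<bar>Im z\<bar> / 2"
proof (rule power2_le_imp_le)
  have "exp (2 * Im z) + inverse (exp (2 * Im z)) \<ge> exp (2 * \<bar>Im z\<bar>)"
    by (cases "Im z \<ge> 0") (auto simp: exp_minus)
  then have "exp (2 * \<bar>Im z\<bar>) / 4 \<le> (exp (2 * Im z) + inverse (exp (2 * Im z)) - 2 * cos (2 * Re z)) / 4"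
    unfolding assms by argo
  then show "(exp \<bar>Im z\<bar> / 2)\<^sup>2 \<le> (norm (sin z))\<^sup>2"
    unfolding norm_sin_squared by (simp add: power_divide exp_double)
qed simp

section \<open>Alternating sums as sums of residues\<close>

lemma sin_pi_eq_0_complex: "sin (of_real pi * z) = 0 \<longleftrightarrow> (\<exists>k::int. z = of_int k)" for z :: complex
proof -
  have "of_real pi * z = of_real (real_of_int k * pi) \<longleftrightarrow> z = of_int k" for k
    by (auto simp: mult.commute)
  then show ?thesis unfolding sin_eq_0 by auto
qed

text \<open>The zero of \<open>sin (pi * s)\<close> at \<open>k\<close> is simple with derivative
  \<open>pi * (-1) ^ k\<close>. Only the limit of \<open>s - k\<close> times the function is used,
  so \<open>h\<close> may vanish at \<open>k\<close>.\<close>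

lemma residue_pi_over_sin:
  assumes h: "h holomorphic_on UNIV"
  shows "residue (\<lambda>s. of_real pi * h s / sin (of_real pi * s)) (of_nat k) = (-1) ^ k * h (of_nat k)"
proof (rule residue_simple'[of "ball (of_nat k) 1"])
  have nz: "sin (of_real pi * s) \<noteq> 0" if "s \<in> ball (of_nat k :: complex) 1 - {of_nat k}" for s
  proof
    assume "sin (of_real pi * s) = 0"
    then obtain j :: int where j: "s = of_int j" unfolding sin_pi_eq_0_complex by auto
    have "dist (of_nat k :: complex) (of_int j) < 1" using that j by simp
    then have "norm (of_int (int k - j) :: complex) < 1" by (simp add: dist_norm)
    then have "j = int k" unfolding norm_of_int by linarith
    then show False using that j by simp
  qed
  show "(\<lambda>s. of_real pi * h s / sin (of_real pi * s)) holomorphic_on ball (of_nat k) 1 - {of_nat k}"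
    using nz by (auto intro!: holomorphic_intros holomorphic_on_subset[OF h])
  have "sin (of_real pi * of_nat k :: complex) = 0"
    using sin_pi_eq_0_complex[of "of_nat k"] by (metis of_int_of_nat_eq)
  moreover have ck: "cos (of_real pi * of_nat k :: complex) = (-1) ^ k"
    using cos_npi2[of k] by (metis cos_of_real of_real_mult of_real_of_nat_eq of_real_power of_real_minus of_real_1)
  moreover have "((\<lambda>s. sin (of_real pi * s)) has_field_derivative of_real pi * cos (of_real pi * of_nat k)) (at (of_nat k :: complex))"
    by (auto intro!: derivative_eq_intros)
  ultimately have "((\<lambda>s. sin (of_real pi * s) / (s - of_nat k)) \<longlongrightarrow> of_real pi * (-1) ^ k) (at (of_nat k :: complex))"
    by (simp add: has_field_derivative_iff)
  moreover have "(h \<longlongrightarrow> h (of_nat k)) (at (of_nat k))"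
    using holomorphic_on_imp_continuous_on[OF h] by (simp add: continuous_on_eq_continuous_at isCont_def)
  ultimately have "((\<lambda>s. of_real pi * h s / (sin (of_real pi * s) / (s - of_nat k)))
      \<longlongrightarrow> of_real pi * h (of_nat k) / (of_real pi * (-1) ^ k)) (at (of_nat k))"
    by (intro tendsto_intros) auto
  moreover have "of_real pi * h (of_nat k) / (of_real pi * (-1) ^ k) = (-1) ^ k * h (of_nat k)"
    by (simp add: field_simps)
  ultimately show "((\<lambda>s. of_real pi * h s / sin (of_real pi * s) * (s - of_nat k))
      \<longlongrightarrow> (-1) ^ k * h (of_nat k)) (at (of_nat k))"
    by simp
qed auto

text \<open>
  The sum is a sum of residues of \<open>\<pi> h(s) / sin (\<pi> s)\<close> over a rectangle; the horizontal sides
  disappear as its height tends to infinity.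
\<close>
lemma alternating_sum_bound:
  fixes h :: "complex \<Rightarrow> complex"
  assumes h: "h holomorphic_on UNIV" and c: "c < pi" and n: "n > 0"
    and strip: "\<And>s. -1/2 \<le> Re s \<Longrightarrow> Re s \<le> real n - 1/2 \<Longrightarrow> norm (h s) \<le> B * exp (c * \<bar>Im s\<bar>)"
    and left: "\<And>y. norm (h (Complex (-1/2) y)) \<le> M1 * exp (c * \<bar>y\<bar>)"
    and right: "\<And>y. norm (h (Complex (real n - 1/2) y)) \<le> M2 * exp (c * \<bar>y\<bar>)"
  shows "norm (\<Sum>k<n. (-1) ^ k * h (of_nat k)) \<le> 2 * (M1 + M2) / (pi - c)"
proof -
  define \<eta> where "\<eta> = pi - c"
  have \<eta>: "\<eta> > 0" using c by (simp add: \<eta>_def)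
  define g where "g = (\<lambda>s. of_real pi * h s / sin (of_real pi * s))"
  define \<Sigma> where "\<Sigma> = (\<Sum>k<n. (-1) ^ k * h (of_nat k))"
  have B: "B \<ge> 0" using order.trans[OF norm_ge_zero strip[of 0]] n by simp
  have M1: "M1 \<ge> 0" using order.trans[OF norm_ge_zero left[of 0]] by simp
  have M2: "M2 \<ge> 0" using order.trans[OF norm_ge_zero right[of 0]] by simp
  \<comment> \<open>An open strip around the rectangles whose only integers are
    \<open>0, ..., n - 1\<close>, the indices of the sum.\<close>
  define S where "S = {s. Re s > -1} \<inter> {s. Re s < real n}"
  define pts where "pts = (of_nat :: nat \<Rightarrow> complex) ` {..<n}"
  have nz: "sin (of_real pi * s) \<noteq> 0" if "s \<in> S - pts" for s
  proof
    assume "sin (of_real pi * s) = 0"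
    then obtain j :: int where j: "s = of_int j" unfolding sin_pi_eq_0_complex by auto
    then have "j > -1" "j < int n" using that by (auto simp: S_def)
    then have "s = of_nat (nat j)" "nat j < n" using j by auto
    then show False using that by (auto simp: pts_def)
  qed
  have S: "open S" "convex S"
    unfolding S_def by (auto intro!: open_Int open_halfspace_Re_gt open_halfspace_Re_lt
        convex_Int convex_halfspace_Re_gt convex_halfspace_Re_lt)
  have holo: "g holomorphic_on S - pts"
    unfolding g_def using nz by (auto intro!: holomorphic_intros holomorphic_on_subset[OF h])
  have res: "residue g (of_nat k) = (-1) ^ k * h (of_nat k)" for k
    unfolding g_def by (rule residue_pi_over_sin[OF h])
  have ng: "norm (g s) = pi * norm (h s) / norm (sin (of_real pi * s))" for s
    by (simp add: g_def norm_mult norm_divide)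
  have vert: "norm (g (Complex x y)) \<le> 2 * pi * M * exp (- \<eta> * \<bar>y\<bar>)"
    if x: "cos (2 * (pi * x)) = -1" and hb: "norm (h (Complex x y)) \<le> M * exp (c * \<bar>y\<bar>)" for x y M
  proof -
    have "norm (sin (of_real pi * Complex x y)) \<ge> exp \<bar>pi * y\<bar> / 2"
      using norm_sin_half_odd_ge[of "of_real pi * Complex x y"] x by simp
    moreover have "0 \<le> pi * (M * exp (c * \<bar>y\<bar>))"
      by (intro mult_nonneg_nonneg[OF _ order.trans[OF norm_ge_zero hb]]) simp
    ultimately have "norm (g (Complex x y)) \<le> pi * (M * exp (c * \<bar>y\<bar>)) / (exp \<bar>pi * y\<bar> / 2)"
      unfolding ng by (intro frac_le mult_left_mono hb) auto
    also have "\<dots> = 2 * pi * M * exp (- \<eta> * \<bar>y\<bar>)"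
      by (simp add: \<eta>_def abs_mult exp_minus exp_diff field_simps flip: exp_add)
    finally show ?thesis .
  qed
  have cosl: "cos (2 * (pi * (-1/2))) = -1" by simp
  have cosr: "cos (2 * (pi * (real n - 1/2))) = -1"
  proof -
    have "2 * (pi * (real n - 1/2)) = 2 * pi * real n - pi" by (simp add: algebra_simps)
    moreover have "cos (2 * pi * real n) = 1" using cos_2npi[of n] by (simp add: mult_ac)
    ultimately show ?thesis by (simp add: cos_diff)
  qed
  \<comment> \<open>The first summand comes from the two vertical sides, uniformly in
    \<open>T\<close>; the second from the two horizontal sides, each of length
    \<open>n\<close>.\<close>
  have est: "2 * pi * norm \<Sigma> \<le> 4 * pi * (M1 + M2) / \<eta> + 8 * pi * B * real n * exp (- \<eta> * T)"
    if T: "T \<ge> 1" for T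
  proof -
    define a1 a2 a3 a4 where "a1 = Complex (-1/2) (-T)" and "a2 = Complex (real n - 1/2) (-T)"
      and "a3 = Complex (real n - 1/2) T" and "a4 = Complex (-1/2) T"
    have ipts: "Im p = 0" "Re p \<noteq> -1/2" "Re p \<noteq> real n - 1/2" "p \<in> box a1 a3" if p: "p \<in> pts" for p
    proof -
      obtain k where k: "k < n" "p = of_nat k" using p by (auto simp: pts_def)
      have "Re p \<in> \<int>" using k by simp
      moreover have "-1/2 \<notin> (\<int> :: real set)" "real n - 1/2 \<notin> \<int>"
      proof -
        have *: "1/2 \<notin> (\<int> :: real set)" using fraction_not_in_Ints[of 2 "1::int", where ?'a = real] by simp
        then show "-1/2 \<notin> (\<int> :: real set)" using Ints_minus[of "-1/2 :: real"] by auto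
        show "real n - 1/2 \<notin> \<int>" using * Ints_diff[of "real n" "real n - 1/2"] by auto
      qed
      ultimately show "Re p \<noteq> -1/2" "Re p \<noteq> real n - 1/2" by metis+
      show "Im p = 0" using k by simp
      show "p \<in> box a1 a3" using k T by (auto simp: in_box_complex_iff a1_def a3_def)
    qed
    have pim: "path_image (rectpath a1 a3) = cbox a1 a3 - box a1 a3"
      using T n by (intro path_image_rectpath_cbox_minus_box) (auto simp: a1_def a3_def)
    have cb: "cbox a1 a3 \<subseteq> S" by (auto simp: in_cbox_complex_iff a1_def a3_def S_def)
    have sub: "path_image (rectpath a1 a3) \<subseteq> S - pts"
      unfolding pim using cb ipts(4) by auto
    have "contour_integral (rectpath a1 a3) g
        = 2 * pi * \<i> * (\<Sum>p\<in>pts. winding_number (rectpath a1 a3) p * residue g p)"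
    proof (rule Residue_theorem[OF S(1) _ _ holo _ _ sub])
      show "\<forall>z. z \<notin> S \<longrightarrow> winding_number (rectpath a1 a3) z = 0"
        using cb T n by (intro allI impI winding_number_rectpath_outside) (auto simp: a1_def a3_def)
    qed (use S convex_connected in \<open>auto simp: pts_def\<close>)
    also have "(\<Sum>p\<in>pts. winding_number (rectpath a1 a3) p * residue g p) = (\<Sum>p\<in>pts. residue g p)"
      using ipts(4) by (intro sum.cong) (auto simp: winding_number_rectpath)
    also have "\<dots> = \<Sigma>"
      unfolding pts_def \<Sigma>_def by (subst sum.reindex) (auto simp: inj_on_def res)
    finally have I: "contour_integral (rectpath a1 a3) g = 2 * pi * \<i> * \<Sigma>" .
    have rp: "rectpath a1 a3 = linepath a1 a2 +++ linepath a2 a3 +++ linepath a3 a4 +++ linepath a4 a1"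
      by (simp add: rectpath_def Let_def a1_def a2_def a3_def a4_def)
    have "path_image (rectpath a1 a3) = closed_segment a1 a2 \<union> closed_segment a2 a3 \<union> closed_segment a3 a4 \<union> closed_segment a4 a1"
      unfolding rp by (simp add: path_image_join Un_assoc)
    then have cont: "continuous_on (closed_segment a1 a2) g" "continuous_on (closed_segment a2 a3) g"
        "continuous_on (closed_segment a3 a4) g" "continuous_on (closed_segment a4 a1) g"
      using sub by (auto intro!: continuous_on_subset[OF holomorphic_on_imp_continuous_on[OF holo]])
    \<comment> \<open>The left side is traversed downwards; reversing it yields the upward segment
      that the vertical bound expects.\<close>
    have sp: "contour_integral (rectpath a1 a3) g = contour_integral (linepath a1 a2) g + contour_integral (linepath a2 a3) g
        + contour_integral (linepath a3 a4) g - contour_integral (linepath a1 a4) g"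
    proof -
      have "contour_integral (linepath a4 a1) g = - contour_integral (linepath a1 a4) g"
        using cont(4) by (subst contour_integral_reverse_linepath[of a4 a1]) (auto)
      then show ?thesis unfolding rp
        using cont by (simp add: contour_integrable_continuous_linepath contour_integrable_join)
    qed
    have v1: "norm (contour_integral (linepath a1 a4) g) \<le> 2 * (2 * pi * M1) / \<eta>"
      unfolding a1_def a4_def
      using cont(4) T \<eta> M1 by (intro contour_integral_vertical_bound vert[OF cosl left])
        (auto simp: a1_def a4_def closed_segment_commute)
    have v2: "norm (contour_integral (linepath a2 a3) g) \<le> 2 * (2 * pi * M2) / \<eta>"
      unfolding a2_def a3_def
      using cont(2) T \<eta> M2 by (intro contour_integral_vertical_bound vert[OF cosr right])
        (auto simp: a2_def a3_def)
    have hb: "norm (g s) \<le> 4 * pi * B * exp (- \<eta> * T)"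
      if s: "\<bar>Im s\<bar> = T" "-1/2 \<le> Re s" "Re s \<le> real n - 1/2" for s
    proof -
      have "pi * T \<ge> 1 * 1" using T pi_gt3 by (intro mult_mono) auto
      then have "norm (sin (of_real pi * s)) \<ge> exp (pi * T) / 4"
        using norm_sin_ge[of "of_real pi * s"] s(1) by (simp add: abs_mult)
      then have "norm (g s) \<le> pi * (B * exp (c * T)) / (exp (pi * T) / 4)"
        unfolding ng using strip[OF s(2,3)] s(1) B by (intro frac_le mult_left_mono) auto
      also have "\<dots> = 4 * pi * B * exp (- \<eta> * T)"
        by (simp add: \<eta>_def exp_minus exp_diff field_simps flip: exp_add)
      finally show ?thesis .
    qed
    have h1: "norm (contour_integral (linepath a1 a2) g) \<le> (4 * pi * B * exp (- \<eta> * T)) * norm (a2 - a1)"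
    proof (rule has_contour_integral_bound_linepath)
      show "(g has_contour_integral contour_integral (linepath a1 a2) g) (linepath a1 a2)"
        by (intro has_contour_integral_integral contour_integrable_continuous_linepath cont)
      fix s assume "s \<in> closed_segment a1 a2"
      then show "norm (g s) \<le> 4 * pi * B * exp (- \<eta> * T)"
        using T n by (intro hb) (auto simp: a1_def a2_def closed_segment_same_Im closed_segment_eq_real_ivl)
    qed (use B in auto)
    have h2: "norm (contour_integral (linepath a3 a4) g) \<le> (4 * pi * B * exp (- \<eta> * T)) * norm (a4 - a3)"
    proof (rule has_contour_integral_bound_linepath)
      show "(g has_contour_integral contour_integral (linepath a3 a4) g) (linepath a3 a4)"
        by (intro has_contour_integral_integral contour_integrable_continuous_linepath cont)
      fix s assume "s \<in> closed_segment a3 a4"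
      then show "norm (g s) \<le> 4 * pi * B * exp (- \<eta> * T)"
        using T n by (intro hb) (auto simp: a3_def a4_def closed_segment_same_Im closed_segment_eq_real_ivl)
    qed (use B in auto)
    have len: "norm (a2 - a1) = real n" "norm (a4 - a3) = real n"
      by (simp_all add: a1_def a2_def a3_def a4_def cmod_def)
    have tri: "norm (u + v + w - x) \<le> norm u + norm v + norm w + norm x" for u v w x :: complex
      using norm_triangle_ineq4[of "u + v + w" x] norm_triangle_ineq[of "u + v" w] norm_triangle_ineq[of u v]
      by linarith
    have "2 * pi * norm \<Sigma> = norm (contour_integral (rectpath a1 a3) g)"
      unfolding I by (simp add: norm_mult)
    also have "\<dots> \<le> norm (contour_integral (linepath a1 a2) g) + norm (contour_integral (linepath a2 a3) g)
        + norm (contour_integral (linepath a3 a4) g) + norm (contour_integral (linepath a1 a4) g)"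
      unfolding sp by (rule tri)
    also have "\<dots> \<le> 4 * pi * (M1 + M2) / \<eta> + 8 * pi * B * real n * exp (- \<eta> * T)"
      using h1 h2 v1 v2 unfolding len by (simp add: add_divide_distrib algebra_simps)
    finally show ?thesis .
  qed
  \<comment> \<open>The limit removes \<open>B\<close>, so the bound on the whole strip may be as
    crude as desired; only the two vertical lines count.\<close>
  have "((\<lambda>T. 4 * pi * (M1 + M2) / \<eta> + 8 * pi * B * real n * exp (- \<eta> * T))
      \<longlongrightarrow> 4 * pi * (M1 + M2) / \<eta> + 8 * pi * B * real n * 0) at_top"
  proof (intro tendsto_intros filterlim_compose[OF exp_at_bot])
    show "filterlim (\<lambda>T. - \<eta> * T) at_bot at_top"
      using \<eta> by (intro filterlim_tendsto_neg_mult_at_bot[OF tendsto_const]) (auto simp: filterlim_ident)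
  qed
  moreover have "\<forall>\<^sub>F T in at_top. 2 * pi * norm \<Sigma> \<le> 4 * pi * (M1 + M2) / \<eta> + 8 * pi * B * real n * exp (- \<eta> * T)"
    using eventually_ge_at_top[of 1] by eventually_elim (rule est)
  ultimately have "2 * pi * norm \<Sigma> \<le> 4 * pi * (M1 + M2) / \<eta> + 8 * pi * B * real n * 0"
    by (intro tendsto_lowerbound) auto
  then have "(2 * pi) * norm \<Sigma> \<le> (2 * pi) * (2 * (M1 + M2) / \<eta>)" by (simp add: algebra_simps)
  then show ?thesis unfolding \<Sigma>_def \<eta>_def
    using pi_gt_zero by (subst (asm) mult_le_cancel_left_pos) auto
qed

section \<open>Convergence and sector decay of the Mittag-Leffler series\<close>

lemma exp_mult_rGamma_progression_tendsto_0:
  fixes \<alpha> c \<gamma> :: real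
  assumes "\<alpha> > 0"
  shows "(\<lambda>k. exp (c * real k) * rGamma (\<alpha> * real k + \<gamma>)) \<longlonglongrightarrow> 0"
proof -
  have "filterlim (\<lambda>k. \<alpha> * real k + \<gamma>) at_top sequentially"
    using assms by real_asymp
  from filterlim_compose[OF exp_mult_rGamma_tendsto_0[of "c / \<alpha>"] this]
  have "(\<lambda>k. exp (- (c * \<gamma> / \<alpha>)) * (exp (c / \<alpha> * (\<alpha> * real k + \<gamma>)) * rGamma (\<alpha> * real k + \<gamma>))) \<longlonglongrightarrow> 0"
    by (rule tendsto_mult_right_zero)
  moreover have "exp (- (c * \<gamma> / \<alpha>)) * (exp (c / \<alpha> * (\<alpha> * real k + \<gamma>)) * rGamma (\<alpha> * real k + \<gamma>))
      = exp (c * real k) * rGamma (\<alpha> * real k + \<gamma>)" for k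
  proof -
    have "c / \<alpha> * (\<alpha> * real k + \<gamma>) = c * real k + c * \<gamma> / \<alpha>"
      using assms by (simp add: field_simps)
    then show ?thesis by (simp add: exp_add exp_minus)
  qed
  ultimately show ?thesis by (simp only:)
qed

lemma summable_Mittag_Leffler:
  fixes \<alpha> \<gamma> :: real and z :: complex
  assumes "\<alpha> > 0"
  shows "summable (\<lambda>k. z ^ k * rGamma (complex_of_real (\<alpha> * real k + \<gamma>)))"
proof (rule summable_comparison_test_ev)
  \<comment> \<open>Since \<open>norm z \<le> exp (norm z)\<close>, the rate \<open>norm z\<close>
    dominates \<open>z ^ k\<close>; the extra \<open>1\<close> leaves the geometric majorant
    \<open>exp (-1) ^ k\<close>.\<close>
  have "(\<lambda>k. exp ((norm z + 1) * real k) * rGamma (\<alpha> * real k + \<gamma>)) \<longlonglongrightarrow> 0"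
    by (rule exp_mult_rGamma_progression_tendsto_0[OF assms])
  then have "\<forall>\<^sub>F k in sequentially. norm (exp ((norm z + 1) * real k) * rGamma (\<alpha> * real k + \<gamma>) - 0) < 1"
    unfolding tendsto_iff dist_norm by (elim allE[of _ 1]) simp
  then show "\<forall>\<^sub>F k in sequentially. norm (z ^ k * rGamma (complex_of_real (\<alpha> * real k + \<gamma>))) \<le> exp (-1) ^ k"
  proof eventually_elim
    case (elim k)
    have "norm z \<le> exp (norm z)" using exp_ge_add_one_self[of "norm z"] by linarith
    then have "norm z ^ k \<le> exp (norm z) ^ k" by (intro power_mono) auto
    also have "\<dots> = exp (norm z * real k)" by (simp add: exp_of_nat2_mult)
    finally have "norm (z ^ k * rGamma (complex_of_real (\<alpha> * real k + \<gamma>)))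
        \<le> exp (norm z * real k) * \<bar>rGamma (\<alpha> * real k + \<gamma>)\<bar>"
      unfolding rGamma_complex_of_real norm_mult norm_power norm_of_real
      by (intro mult_right_mono) auto
    also have "\<dots> = exp (- real k) * norm (exp ((norm z + 1) * real k) * rGamma (\<alpha> * real k + \<gamma>))"
      by (simp add: abs_mult distrib_right exp_add exp_minus)
    also have "\<dots> \<le> exp (- real k) * 1" using elim by (intro mult_left_mono) auto
    also have "\<dots> = exp (-1) ^ k" by (simp flip: exp_of_nat_mult)
    finally show ?case .
  qed
  show "summable (\<lambda>k. exp (-1 :: real) ^ k)" by (rule summable_geometric) simp
qed

text \<open>On vertical lines \<open>exp (s * L)\<close> grows at rate at most
  \<open>\<theta>\<close> and \<open>1/Gamma(\<alpha> * s + \<gamma>)\<close> at rate just above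
  \<open>pi * \<alpha> / 2\<close>; the angle condition lets \<open>sin (pi * s)\<close> beat both.
  The factor \<open>exp (- Re L / 2)\<close> is the size of \<open>exp (s * L)\<close> on
  \<open>Re s = -1/2\<close>, up to that growth.\<close>

lemma Mittag_Leffler_sector_decay:
  fixes \<alpha> \<gamma> \<theta> :: real
  assumes \<alpha>: "\<alpha> > 0" and \<theta>: "\<theta> + pi * \<alpha> / 2 < pi"
  shows "\<exists>C. \<forall>L. \<bar>Im L\<bar> \<le> \<theta> \<longrightarrow> norm (Mittag_Leffler \<alpha> \<gamma> (- exp L)) \<le> C * exp (- Re L / 2)"
proof -
  \<comment> \<open>Half of the available gap: \<open>\<epsilon>\<close> spends one \<open>d\<close>
    in the growth of \<open>1/Gamma\<close>, and the other remains as
    \<open>pi - c = d > 0\<close>.\<close>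
  define d where "d = (pi - \<theta> - pi * \<alpha> / 2) / 2"
  define c where "c = pi - d"
  define \<epsilon> where "\<epsilon> = d / \<alpha>"
  have d: "d > 0" using \<theta> by (simp add: d_def)
  have \<epsilon>: "\<epsilon> > 0" using d \<alpha> by (simp add: \<epsilon>_def)
  have ceq: "\<theta> + (pi / 2 + \<epsilon>) * \<alpha> = c"
    using \<alpha> by (simp add: c_def \<epsilon>_def d_def field_simps)
  \<comment> \<open>A strip of width zero, the image of \<open>Re s = -1/2\<close>.
    \<open>C0\<close> is fixed before \<open>L\<close>, which makes the final constant
    uniform.\<close>
  obtain C0 where C0: "norm (rGamma z) \<le> C0 * exp ((pi / 2 + \<epsilon>) * \<bar>Im z\<bar>)"
    if "Re z = \<gamma> - \<alpha> / 2" for z :: complex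
    using rGamma_strip_bound[OF \<epsilon>, of "\<gamma> - \<alpha> / 2" "\<gamma> - \<alpha> / 2"] order_refl by metis
  have "norm (Mittag_Leffler \<alpha> \<gamma> (- exp L)) \<le> 2 * C0 / d * exp (- Re L / 2)" if L: "\<bar>Im L\<bar> \<le> \<theta>" for L
  proof -
    define \<rho> where "\<rho> = Re L"
    define h where "h = (\<lambda>s. exp (s * L) * rGamma (of_real \<alpha> * s + of_real \<gamma>))"
    have h: "h holomorphic_on UNIV" unfolding h_def by (intro holomorphic_intros)
    have hb: "norm (h s) \<le> exp (Re s * \<rho>) * M * exp (c * \<bar>Im s\<bar>)"
      if "norm (rGamma (of_real \<alpha> * s + of_real \<gamma>)) \<le> M * exp ((pi / 2 + \<epsilon>) * (\<alpha> * \<bar>Im s\<bar>))" for s M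
    proof -
      have "- (Im s * Im L) \<le> \<bar>Im s\<bar> * \<bar>Im L\<bar>" by (metis abs_ge_minus_self abs_mult)
      also have "\<dots> \<le> \<theta> * \<bar>Im s\<bar>" using L by (subst mult.commute) (intro mult_right_mono, auto)
      finally have "norm (exp (s * L)) \<le> exp (Re s * \<rho> + \<theta> * \<bar>Im s\<bar>)" by (simp add: \<rho>_def)
      then have "norm (h s) \<le> exp (Re s * \<rho> + \<theta> * \<bar>Im s\<bar>) * (M * exp ((pi / 2 + \<epsilon>) * (\<alpha> * \<bar>Im s\<bar>)))"
        unfolding h_def norm_mult by (intro mult_mono that) auto
      also have "\<dots> = exp (Re s * \<rho>) * M * exp (c * \<bar>Im s\<bar>)"
        unfolding ceq[symmetric] by (simp add: algebra_simps exp_add)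
      finally show ?thesis .
    qed
    define M1 where "M1 = exp (-1/2 * \<rho>) * C0"
    \<comment> \<open>On the right side the explicit bound for \<open>Re \<ge> 1\<close> is used
      instead of the strip bound, whose constant is not controlled as \<open>n\<close>
      grows.\<close>
    define M2 where "M2 = (\<lambda>n. exp ((real n - 1/2) * \<rho>) * rGamma (\<alpha> * (real n - 1/2) + \<gamma>))"
    have summand: "(-1) ^ k * h (of_nat k) = (- exp L) ^ k * rGamma (complex_of_real (\<alpha> * real k + \<gamma>))" for k
      unfolding power_minus[of "exp L"] h_def by (simp add: exp_of_nat_mult)
    have bound: "norm (\<Sum>k<n. (- exp L) ^ k * rGamma (complex_of_real (\<alpha> * real k + \<gamma>))) \<le> 2 * (M1 + M2 n) / d"
      if n: "n > 0" "\<alpha> * (real n - 1/2) + \<gamma> \<ge> 1" for n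
    proof -
      \<comment> \<open>\<open>C1\<close> depends on \<open>n\<close>, harmlessly: it enters only
        the constant \<open>B\<close> of the alternating sum bound.\<close>
      obtain C1 where C1: "C1 \<ge> 0" "\<And>z :: complex. \<gamma> - \<alpha> / 2 \<le> Re z \<Longrightarrow> Re z \<le> \<alpha> * (real n - 1/2) + \<gamma> \<Longrightarrow>
          norm (rGamma z) \<le> C1 * exp ((pi / 2 + \<epsilon>) * \<bar>Im z\<bar>)"
        using rGamma_strip_bound[OF \<epsilon>, of "\<gamma> - \<alpha> / 2" "\<alpha> * (real n - 1/2) + \<gamma>"] by metis
      have "norm (\<Sum>k<n. (-1) ^ k * h (of_nat k)) \<le> 2 * (M1 + M2 n) / (pi - c)"
      proof (rule alternating_sum_bound[OF h _ n(1), where B = "exp (real n * \<bar>\<rho>\<bar>) * C1"])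
        show "c < pi" using d by (simp add: c_def)
        show "norm (h (Complex (-1/2) y)) \<le> M1 * exp (c * \<bar>y\<bar>)" for y
          using hb[of "Complex (-1/2) y" C0] C0[of "of_real \<alpha> * Complex (-1/2) y + of_real \<gamma>"] \<alpha>
          by (simp add: M1_def abs_mult)
        show "norm (h (Complex (real n - 1/2) y)) \<le> M2 n * exp (c * \<bar>y\<bar>)" for y
        proof -
          let ?w = "of_real \<alpha> * Complex (real n - 1/2) y + of_real \<gamma>"
          have r: "rGamma (\<alpha> * (real n - 1/2) + \<gamma>) \<ge> 0"
            using n(2) by (simp add: rGamma_inverse_Gamma Gamma_real_nonneg)
          have "norm (rGamma ?w) \<le> rGamma (\<alpha> * (real n - 1/2) + \<gamma>) * exp (pi * (\<alpha> * \<bar>y\<bar>) / 2)"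
            using norm_rGamma_le[of ?w] n(2) \<alpha> by (simp add: abs_mult)
          also have "\<dots> \<le> rGamma (\<alpha> * (real n - 1/2) + \<gamma>) * exp ((pi / 2 + \<epsilon>) * (\<alpha> * \<bar>y\<bar>))"
          proof -
            have "\<epsilon> * (\<alpha> * \<bar>y\<bar>) \<ge> 0" using \<epsilon> \<alpha> by simp
            then have "pi * (\<alpha> * \<bar>y\<bar>) / 2 \<le> (pi / 2 + \<epsilon>) * (\<alpha> * \<bar>y\<bar>)" by (simp add: distrib_right)
            then show ?thesis by (intro mult_left_mono r) (simp only: exp_le_cancel_iff)
          qed
          finally show ?thesis
            using hb[of "Complex (real n - 1/2) y"] by (simp add: M2_def)
        qed
        show "norm (h s) \<le> exp (real n * \<bar>\<rho>\<bar>) * C1 * exp (c * \<bar>Im s\<bar>)"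
          if s: "-1/2 \<le> Re s" "Re s \<le> real n - 1/2" for s
        proof -
          let ?w = "of_real \<alpha> * s + of_real \<gamma>"
          have "\<alpha> * (-1/2) \<le> \<alpha> * Re s"
            using s(1) \<alpha> by (intro mult_left_mono) simp_all
          moreover have "\<alpha> * Re s \<le> \<alpha> * (real n - 1/2)"
            using s(2) \<alpha> by (intro mult_left_mono) simp_all
          ultimately have "norm (h s) \<le> exp (Re s * \<rho>) * C1 * exp (c * \<bar>Im s\<bar>)"
            using C1(2)[of ?w] \<alpha> by (intro hb) (auto simp: abs_mult)
          moreover have "Re s * \<rho> \<le> real n * \<bar>\<rho>\<bar>"
          proof -
            have "\<bar>Re s\<bar> \<le> real n" using s n(1) by linarith
            then have "\<bar>Re s\<bar> * \<bar>\<rho>\<bar> \<le> real n * \<bar>\<rho>\<bar>" by (intro mult_right_mono) simp_all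
            then show ?thesis using abs_ge_self[of "Re s * \<rho>"] unfolding abs_mult by linarith
          qed
          then have "exp (Re s * \<rho>) * C1 * exp (c * \<bar>Im s\<bar>) \<le> exp (real n * \<bar>\<rho>\<bar>) * C1 * exp (c * \<bar>Im s\<bar>)"
            using C1(1) by (intro mult_right_mono) simp_all
          ultimately show ?thesis by linarith
        qed
      qed
      then show ?thesis by (simp add: summand c_def)
    qed
    have "(\<lambda>n. exp (- \<rho> / 2) * (exp (\<rho> * real n) * rGamma (\<alpha> * real n + (\<gamma> - \<alpha> / 2)))) \<longlonglongrightarrow> 0"
      by (intro tendsto_mult_right_zero exp_mult_rGamma_progression_tendsto_0 \<alpha>)
    moreover have "exp (- \<rho> / 2) * (exp (\<rho> * real n) * rGamma (\<alpha> * real n + (\<gamma> - \<alpha> / 2))) = M2 n" for n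
      unfolding M2_def by (simp add: algebra_simps flip: exp_add mult.assoc)
    ultimately have "M2 \<longlonglongrightarrow> 0" by (simp only:)
    then have lim2: "(\<lambda>n. 2 * (M1 + M2 n) / d) \<longlonglongrightarrow> 2 * (M1 + 0) / d"
      using d by (intro tendsto_intros) auto
    have lim1: "(\<lambda>n. norm (\<Sum>k<n. (- exp L) ^ k * rGamma (complex_of_real (\<alpha> * real k + \<gamma>))))
        \<longlonglongrightarrow> norm (Mittag_Leffler \<alpha> \<gamma> (- exp L))"
      unfolding Mittag_Leffler_def
      by (intro tendsto_norm summable_LIMSEQ summable_Mittag_Leffler \<alpha>)
    have "\<forall>\<^sub>F n in sequentially. \<alpha> * (real n - 1/2) + \<gamma> \<ge> 1"
      using \<alpha> by real_asymp
    then have "\<forall>\<^sub>F n in sequentially. norm (\<Sum>k<n. (- exp L) ^ k * rGamma (complex_of_real (\<alpha> * real k + \<gamma>)))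
        \<le> 2 * (M1 + M2 n) / d"
      using eventually_gt_at_top[of 0] by eventually_elim (rule bound)
    then have "norm (Mittag_Leffler \<alpha> \<gamma> (- exp L)) \<le> 2 * (M1 + 0) / d"
      by (intro tendsto_le[OF _ lim2 lim1]) auto
    also have "\<dots> = 2 * C0 / d * exp (- Re L / 2)" by (simp add: M1_def \<rho>_def)
    finally show ?thesis .
  qed
  then show ?thesis by blast
qed

section \<open>Leading term near the negative axis and the counterexample\<close>

lemma Mittag_Leffler_shift:
  fixes \<alpha> \<gamma> :: real and z :: complex
  assumes "\<alpha> > 0"
  shows "z * Mittag_Leffler \<alpha> (\<gamma> + \<alpha>) z = Mittag_Leffler \<alpha> \<gamma> z - of_real (rGamma \<gamma>)"
proof -
  let ?f = "\<lambda>k. z ^ k * rGamma (complex_of_real (\<alpha> * real k + \<gamma>))"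
  have "z * Mittag_Leffler \<alpha> (\<gamma> + \<alpha>) z = (\<Sum>k. z * (z ^ k * rGamma (complex_of_real (\<alpha> * real k + (\<gamma> + \<alpha>)))))"
    unfolding Mittag_Leffler_def by (intro suminf_mult[symmetric] summable_Mittag_Leffler assms)
  also have "\<dots> = (\<Sum>k. ?f (Suc k))"
    by (simp add: algebra_simps)
  also have "\<dots> = Mittag_Leffler \<alpha> \<gamma> z - ?f 0"
    unfolding Mittag_Leffler_def by (intro suminf_split_head summable_Mittag_Leffler assms)
  finally show ?thesis by (simp add: rGamma_complex_of_real)
qed

text \<open>Two steps of the recurrence reach \<open>x + 2\<close> in \<open>(0, 1)\<close> with two
  negative factors. This settles the sign for \<open>\<beta> < \<alpha> - 1\<close>, where
  \<open>\<beta> - \<alpha>\<close> lies in \<open>(-2, -1)\<close>.\<close>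

lemma rGamma_pos_minus2_minus1:
  fixes x :: real
  assumes "-2 < x" "x < -1"
  shows "rGamma x > 0"
proof -
  have "rGamma x = (x * (x + 1)) * rGamma (x + 2)"
    using rGamma_plus1[of x] rGamma_plus1[of "x + 1"] by (simp add: mult.assoc add.assoc)
  moreover have "x * (x + 1) > 0" using assms by (intro mult_neg_neg) auto
  moreover have "rGamma (x + 2) > 0" using assms by (simp add: rGamma_inverse_Gamma Gamma_real_pos)
  ultimately show ?thesis by (metis mult_pos_pos)
qed

(* Mittag_Leffler is real-valued on the real line, so Re only serves to compare with the norm. *)
theorem proposition14:
  fixes \<alpha> \<beta> :: real
  assumes "\<alpha> \<in> {1<..<2}"
    and "\<beta> \<in> {0..<\<alpha> - 1} \<union> {\<alpha><..}"
  shows "\<exists>z :: complex. norm (Mittag_Leffler \<alpha> \<beta> z)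
           < Re (Mittag_Leffler \<alpha> \<beta> (complex_of_real (Re z)))"
proof -
  define \<gamma> where "\<gamma> = \<beta> - \<alpha>"
  define r where "r = rGamma \<gamma>"
  \<comment> \<open>Half of the critical angle \<open>pi * (1 - \<alpha> / 2)\<close> of the decay
    estimate: positive as \<open>\<alpha> < 2\<close>, and below \<open>pi / 2\<close>, so that
    \<open>cos \<theta> > 0\<close>.\<close>
  define \<theta> where "\<theta> = pi * (1 - \<alpha> / 2) / 2"
  have \<alpha>: "\<alpha> > 0" using assms by simp
  have r: "r > 0"
  proof (cases "\<beta> > \<alpha>")
    case True
    then show ?thesis by (simp add: r_def \<gamma>_def rGamma_inverse_Gamma Gamma_real_pos)
  next
    case False
    then show ?thesis using assms unfolding r_def by (intro rGamma_pos_minus2_minus1) (auto simp: \<gamma>_def)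
  qed
  have \<theta>: "0 < \<theta>" "\<theta> < pi / 2" "\<theta> + pi * \<alpha> / 2 < pi"
    using assms by (auto simp: \<theta>_def field_simps)
  define q where "q = cos \<theta>"
  have q: "0 < q" "q < 1"
    using \<theta> cos_gt_zero_pi[of \<theta>] cos_monotone_0_pi[of 0 \<theta>] by (auto simp: q_def)
  obtain C where C: "\<And>L. \<bar>Im L\<bar> \<le> \<theta> \<Longrightarrow> norm (Mittag_Leffler \<alpha> \<gamma> (- exp L)) \<le> C * exp (- Re L / 2)"
    using Mittag_Leffler_sector_decay[OF \<alpha> \<theta>(3)] by blast
  have shift: "z * Mittag_Leffler \<alpha> \<beta> z = Mittag_Leffler \<alpha> \<gamma> z - of_real r" for z
    using Mittag_Leffler_shift[OF \<alpha>, of z \<gamma>] by (simp add: \<gamma>_def r_def)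
  \<comment> \<open>With \<open>\<rho> = ln (norm z)\<close> and
    \<open>x = - Re z = q * norm z\<close>, the first summand will bound
    \<open>x * norm (E(z))\<close> and the second the deviation of \<open>x * Re (E(-x))\<close>
    from \<open>r\<close>. Both errors vanish, leaving \<open>q * r < r\<close>.\<close>
  have "((\<lambda>\<rho>. q * (r + C * exp (- \<rho> / 2)) + C * exp (- (\<rho> + ln q) / 2)) \<longlongrightarrow> q * r) at_top"
    by real_asymp
  moreover have "q * r < r" using q r by simp
  ultimately have "\<forall>\<^sub>F \<rho> in at_top. q * (r + C * exp (- \<rho> / 2)) + C * exp (- (\<rho> + ln q) / 2) < r"
    by (rule order_tendstoD)
  then obtain \<rho> where \<rho>: "q * (r + C * exp (- \<rho> / 2)) + C * exp (- (\<rho> + ln q) / 2) < r"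
    by (meson eventually_at_top_linorder order_refl)
  define z where "z = - exp (Complex \<rho> \<theta>)"
  define x where "x = exp \<rho> * q"
  have x: "x > 0" using q by (simp add: x_def)
  have Rez: "Re z = - x" by (simp add: z_def x_def q_def Re_exp)
  \<comment> \<open>The real comparison point has the form \<open>- exp L\<close> with
    \<open>Im L = 0\<close>, so the same decay estimate covers it.\<close>
  have x_eq: "- complex_of_real x = - exp (of_real (\<rho> + ln q))"
    using q by (simp add: x_def exp_of_real exp_add exp_ln flip: of_real_add)
  have "exp \<rho> * norm (Mittag_Leffler \<alpha> \<beta> z) = norm (Mittag_Leffler \<alpha> \<gamma> z - of_real r)"
    unfolding shift[symmetric] by (simp add: norm_mult z_def)
  also have "\<dots> \<le> C * exp (- \<rho> / 2) + r"
    using norm_triangle_ineq4[of "Mittag_Leffler \<alpha> \<gamma> z" "of_real r"] C[of "Complex \<rho> \<theta>"] \<theta> r by (simp add: z_def)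
  finally have "q * (exp \<rho> * norm (Mittag_Leffler \<alpha> \<beta> z)) \<le> q * (C * exp (- \<rho> / 2) + r)"
    using q by (intro mult_left_mono) auto
  then have up: "x * norm (Mittag_Leffler \<alpha> \<beta> z) \<le> q * (r + C * exp (- \<rho> / 2))"
    by (simp add: x_def algebra_simps)
  have "norm (Mittag_Leffler \<alpha> \<gamma> (- of_real x)) \<le> C * exp (- (\<rho> + ln q) / 2)"
    using C[of "of_real (\<rho> + ln q)"] \<theta> unfolding x_eq by simp
  then have "Re (Mittag_Leffler \<alpha> \<gamma> (- of_real x)) \<le> C * exp (- (\<rho> + ln q) / 2)"
    using complex_Re_le_cmod order.trans by blast
  moreover have "x * Re (Mittag_Leffler \<alpha> \<beta> (- of_real x)) = r - Re (Mittag_Leffler \<alpha> \<gamma> (- of_real x))"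
    using arg_cong[OF shift[of "- of_real x"], of Re] by simp
  ultimately have "x * norm (Mittag_Leffler \<alpha> \<beta> z) < x * Re (Mittag_Leffler \<alpha> \<beta> (- of_real x))"
    using up \<rho> by linarith
  then have "norm (Mittag_Leffler \<alpha> \<beta> z) < Re (Mittag_Leffler \<alpha> \<beta> (complex_of_real (Re z)))"
    using x by (simp add: Rez)
  then show ?thesis by blast
qed

end
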